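(* Let $\mathcal D$ be a smooth closed convex subset of $\mathbb R^2$ with nonempty interior and $O$ a point outside it. The following statements hold for every $\varphi$ from the interior of the domain $D$ of $\tilde g$: (i) The function $\tilde g$ is differentiable at $\varphi$. (ii) $\tilde g'(\varphi)=0$ if and only if CPP holds for the lines $t_1(\varphi)$, $t_2(\varphi)$, $l(\varphi)$ and the points $\tilde A(\varphi),\tilde B(\varphi),O$, respectively. In particular, CPP holds for every local minimizer $\varphi_*$ and every local maximizer $\varphi^*$ of the function $\tilde g$ (whenever $\varphi_*$ and $\varphi^*$ are from the interior of the domain $D$ of $\tilde g$).
   Context: $l(\varphi)$ denotes the line through $O$ obtained by rotating a fixed line through $O$ by the angle $\varphi$ (in radians) around $O$. $D$ is the set of all $\varphi$ such that $l(\varphi)\cap\mathcal D$ is a nonempty (bounded) segment $[\tilde A(\varphi)\tilde B(\varphi)]$, with the end-points labelled so that $\tilde B(\varphi)\in[O\tilde A(\varphi)]$; $\tilde g:D\to\mathbb R$ is given by $\tilde g(\varphi)=|O\tilde A(\varphi)|-|O\tilde B(\varphi)|=|\tilde A(\varphi)\tilde B(\varphi)|$. For $\varphi\in D$, $t_1(\varphi)$ and $t_2(\varphi)$ are the tangents to $\partial\mathcal D$ at $\tilde A(\varphi)$ and $\tilde B(\varphi)$, respectively. A line $p$ is tangent to a curve $\gamma\subset\mathbb R^2$ at a point $P_0\in p\cap\gamma$ if there is an open disc $U$ centered at $P_0$ such that, in a rectangular coordinate system with $p$ as abscissa axis, $\gamma\cap U$ is the graph of a continuous real-valued function which is differentiable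 at $P_0$ with derivative zero there. A convex set $\mathcal D\subset\mathbb R^2$ is smooth if its boundary $\partial\mathcal D$ has a tangent at every point (equivalently, for closed convex sets with nonempty interior: there is exactly one supporting line at every boundary point, and that line is the tangent). CPP (Concurrent Perpendiculars Property) for lines $l_1\ni A$, $l_2\ni B$, a line $l$ passing through $A,B,O$, and the points $A,B,O$: the perpendicular to $l_1$ at $A$, the perpendicular to $l_2$ at $B$ and the perpendicular to $l$ at $O$ have a common point. *)

theory Defs
  imports "HOL-Analysis.Analysis"
begin

definition rot :: "real \<Rightarrow> real^2 \<Rightarrow> real^2" where
  "rot \<phi> v = vector [cos \<phi> * v$1 - sin \<phi> * v$2, sin \<phi> * v$1 + cos \<phi> * v$2]"

definition is_line :: "(real^2) set \<Rightarrow> bool" where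
  "is_line p \<longleftrightarrow> affine p \<and> aff_dim p = 1"

definition rotated_line :: "real^2 \<Rightarrow> (real^2) set \<Rightarrow> real \<Rightarrow> (real^2) set" where
  "rotated_line c L0 \<phi> = (\<lambda>x. c + rot \<phi> (x - c)) ` L0"

text \<open>
  \<open>u\<close>, \<open>v\<close> are the axis directions of a rectangular coordinate system with origin \<open>P\<close> and
  abscissa axis \<open>p\<close>. The function whose graph is the curve near \<open>P\<close> is the restriction of
  \<open>f\<close> to \<open>S\<close>; the point \<open>P\<close> itself has coordinates \<open>(0, 0)\<close>, and \<open>0\<close> is an interior point
  of \<open>S\<close>, so that the derivative of \<open>f\<close> at \<open>0\<close> only depends on this restriction.
\<close>

definition is_tangent :: "(real^2) set \<Rightarrow> (real^2) set \<Rightarrow> real^2 \<Rightarrow> bool" where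
  "is_tangent p \<gamma> P \<longleftrightarrow> P \<in> \<gamma> \<and>
    (\<exists>u v. norm u = 1 \<and> norm v = 1 \<and> u \<bullet> v = 0 \<and> p = range (\<lambda>s. P + s *\<^sub>R u) \<and>
      (\<exists>r>0. \<exists>(S :: real set) (f :: real \<Rightarrow> real).
        0 \<in> interior S \<and> continuous_on S f \<and> (f has_real_derivative 0) (at 0) \<and>
        \<gamma> \<inter> ball P r = (\<lambda>s. P + s *\<^sub>R u + f s *\<^sub>R v) ` S))"

definition smooth_boundary :: "(real^2) set \<Rightarrow> bool" where
  "smooth_boundary K \<longleftrightarrow> (\<forall>P \<in> frontier K. \<exists>p. is_tangent p (frontier K) P)"

definition tangent_at :: "(real^2) set \<Rightarrow> real^2 \<Rightarrow> (real^2) set" where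
  "tangent_at \<gamma> P = (THE p. is_tangent p \<gamma> P)"

definition perpendicular_at :: "(real^2) set \<Rightarrow> real^2 \<Rightarrow> (real^2) set" where
  "perpendicular_at p P = {x. \<forall>y \<in> p. orthogonal (x - P) (y - P)}"

definition CPP ::
  "(real^2) set \<Rightarrow> (real^2) set \<Rightarrow> (real^2) set \<Rightarrow> real^2 \<Rightarrow> real^2 \<Rightarrow> real^2 \<Rightarrow> bool" where
  "CPP l1 l2 l A B c \<longleftrightarrow>
    (\<exists>x. x \<in> perpendicular_at l1 A \<and> x \<in> perpendicular_at l2 B \<and> x \<in> perpendicular_at l c)"

text \<open>
  In the following, \<open>c\<close> is the point around which the line \<open>L0\<close> is rotated. Segments may be
  degenerate, as in \<^const>\<open>closed_segment\<close>, so lines touching \<open>K\<close> in one point are included.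
  For \<open>c \<notin> K\<close> the labelling of the end-points in \<open>is_chord\<close> exists and is unique at every
  angle in \<open>chord_dom\<close>; \<open>far_end\<close>, \<open>near_end\<close> and \<open>chord_length\<close> are meaningful only there.
\<close>

definition chord_dom :: "real^2 \<Rightarrow> (real^2) set \<Rightarrow> (real^2) set \<Rightarrow> real set" where
  "chord_dom c L0 K = {\<phi>. \<exists>A B. rotated_line c L0 \<phi> \<inter> K = closed_segment A B}"

definition is_chord ::
  "real^2 \<Rightarrow> (real^2) set \<Rightarrow> (real^2) set \<Rightarrow> real \<Rightarrow> real^2 \<Rightarrow> real^2 \<Rightarrow> bool" where
  "is_chord c L0 K \<phi> A B \<longleftrightarrow>
    rotated_line c L0 \<phi> \<inter> K = closed_segment A B \<and> B \<in> closed_segment c A"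

definition far_end :: "real^2 \<Rightarrow> (real^2) set \<Rightarrow> (real^2) set \<Rightarrow> real \<Rightarrow> real^2" where
  "far_end c L0 K \<phi> = (THE A. \<exists>B. is_chord c L0 K \<phi> A B)"

definition near_end :: "real^2 \<Rightarrow> (real^2) set \<Rightarrow> (real^2) set \<Rightarrow> real \<Rightarrow> real^2" where
  "near_end c L0 K \<phi> = (THE B. \<exists>A. is_chord c L0 K \<phi> A B)"

definition chord_length :: "real^2 \<Rightarrow> (real^2) set \<Rightarrow> (real^2) set \<Rightarrow> real \<Rightarrow> real" where
  "chord_length c L0 K \<phi> = dist c (far_end c L0 K \<phi>) - dist c (near_end c L0 K \<phi>)"

definition CPP_at :: "real^2 \<Rightarrow> (real^2) set \<Rightarrow> (real^2) set \<Rightarrow> real \<Rightarrow> bool" where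
  "CPP_at c L0 K \<phi> \<longleftrightarrow>
    CPP (tangent_at (frontier K) (far_end c L0 K \<phi>)) (tangent_at (frontier K) (near_end c L0 K \<phi>))
      (rotated_line c L0 \<phi>) (far_end c L0 K \<phi>) (near_end c L0 K \<phi>) c"

definition local_minimizer :: "real set \<Rightarrow> (real \<Rightarrow> real) \<Rightarrow> real \<Rightarrow> bool" where
  "local_minimizer D g x \<longleftrightarrow> x \<in> D \<and> (\<exists>e>0. \<forall>y \<in> D. \<bar>y - x\<bar> < e \<longrightarrow> g x \<le> g y)"

definition local_maximizer :: "real set \<Rightarrow> (real \<Rightarrow> real) \<Rightarrow> real \<Rightarrow> bool" where
  "local_maximizer D g x \<longleftrightarrow> x \<in> D \<and> (\<exists>e>0. \<forall>y \<in> D. \<bar>y - x\<bar> < e \<longrightarrow> g y \<le> g x)"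

end

theory Submission
  imports Defs
begin

text \<open>
  A line through \<open>c\<close> at an interior angle of the domain meets the interior of \<open>K\<close>: all nearby
  lines meet \<open>K\<close>, necessarily on the same side of \<open>c\<close>, hence \<open>K\<close> has points on both sides of the
  line. Both ends of its chord are then continuous in the angle and the tangents there are
  transversal to the line. With \<open>E\<close> the unit direction of the line and \<open>J\<close> the quarter turn, an end
  \<open>c + a E\<close> with tangent direction \<open>u\<close> satisfies \<open>a' = a (u \<bullet> E) / (u \<bullet> J E)\<close>. This is also the
  coordinate along \<open>J E\<close> of the point where the perpendicular to the tangent meets the perpendicular
  to the line at \<open>c\<close> (the polar subnormal), so the perpendiculars concur exactly when the derivatives
  at the two ends agree.
\<close>

section \<open>Rotations and quarter turns of the plane\<close>

definition quarter_turn :: "real^2 \<Rightarrow> real^2" where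
  "quarter_turn v = vector [- v$2, v$1]"

lemma quarter_turn_nth [simp]: "quarter_turn v $ 1 = - v$2" "quarter_turn v $ 2 = v$1"
  by (simp_all add: quarter_turn_def)

lemma inner_real2: "(x :: real^2) \<bullet> y = x$1 * y$1 + x$2 * y$2"
  by (simp add: inner_vec_def sum_2)

lemma rot_nth [simp]:
  "rot \<phi> v $ 1 = cos \<phi> * v$1 - sin \<phi> * v$2"
  "rot \<phi> v $ 2 = sin \<phi> * v$1 + cos \<phi> * v$2"
  by (simp_all add: rot_def)

lemma rot_eq_quarter_turn: "rot \<phi> v = cos \<phi> *\<^sub>R v + sin \<phi> *\<^sub>R quarter_turn v"
  by (simp add: vec_eq_iff forall_2)

lemma rot_minus: "rot \<phi> (- v) = - rot \<phi> v"
  by (simp add: vec_eq_iff forall_2)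

lemma rot_scaleR: "rot \<phi> (t *\<^sub>R v) = t *\<^sub>R rot \<phi> v"
  by (simp add: vec_eq_iff forall_2 algebra_simps)

lemma quarter_turn_minus: "quarter_turn (- v) = - quarter_turn v"
  by (simp add: vec_eq_iff forall_2)

lemma inner_quarter_turn_self [simp]: "v \<bullet> quarter_turn v = 0" "quarter_turn v \<bullet> v = 0"
  by (simp_all add: inner_real2)

lemma inner_quarter_turn_quarter_turn [simp]: "quarter_turn v \<bullet> quarter_turn w = v \<bullet> w"
  by (simp add: inner_real2)

lemma norm_quarter_turn [simp]: "norm (quarter_turn v) = norm v"
  by (simp add: norm_eq_sqrt_inner)

lemma inner_rot_rot: "rot \<psi> v \<bullet> rot \<phi> v = cos (\<psi> - \<phi>) * (v \<bullet> v)"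
  by (simp add: inner_real2 cos_diff algebra_simps)

lemma inner_rot_quarter_turn_rot: "rot \<psi> v \<bullet> quarter_turn (rot \<phi> v) = sin (\<psi> - \<phi>) * (v \<bullet> v)"
  by (simp add: inner_real2 sin_diff algebra_simps)

lemma norm_rot [simp]: "norm (rot \<phi> v) = norm v"
  by (simp add: norm_eq_sqrt_inner inner_rot_rot)

lemma rot_nonzero: "norm v = 1 \<Longrightarrow> rot \<phi> v \<noteq> 0"
  by (metis norm_rot norm_zero zero_neq_one)

lemma tendsto_rot: "((\<lambda>\<psi>. rot \<psi> v) \<longlongrightarrow> rot \<phi> v) (at \<phi>)"
  unfolding rot_eq_quarter_turn by (intro tendsto_intros)

lemma tendsto_quarter_turn: "(f \<longlongrightarrow> l) F \<Longrightarrow> ((\<lambda>x. quarter_turn (f x)) \<longlongrightarrow> quarter_turn l) F"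
proof (rule vec_tendstoI)
  fix i :: 2
  assume "(f \<longlongrightarrow> l) F"
  then have f: "((\<lambda>x. f x $ k) \<longlongrightarrow> l $ k) F" for k by (rule tendsto_vec_nth)
  then show "((\<lambda>x. quarter_turn (f x) $ i) \<longlongrightarrow> quarter_turn l $ i) F"
    using exhaust_2[of i] tendsto_minus[OF f[of 2]] f[of 1] by auto
qed

lemma orthonormal_expansion:
  fixes x e :: "real^2"
  assumes "norm e = 1"
  shows "x = (x \<bullet> e) *\<^sub>R e + (x \<bullet> quarter_turn e) *\<^sub>R quarter_turn e"
proof -
  have e: "e$1 * e$1 + e$2 * e$2 = 1"
    using assms by (metis inner_real2 norm_eq_1)
  have "x$1 = x$1 * (e$1 * e$1 + e$2 * e$2)" "x$2 = x$2 * (e$1 * e$1 + e$2 * e$2)"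
    by (simp_all add: e)
  then show ?thesis
    by (simp add: vec_eq_iff forall_2 inner_real2 algebra_simps)
qed

section \<open>Lines through the centre and their perpendiculars\<close>

text \<open>Taking \<open>c\<close> as origin and a unit direction makes the parameter
  \<open>t\<close> a signed distance from \<open>c\<close>. After rotation it serves as a polar
  radius that may be negative.\<close>

lemma is_line_through:
  assumes "is_line L" and "c \<in> L"
  obtains e where "norm e = 1" and "L = range (\<lambda>t. c + t *\<^sub>R e)"
proof -
  have L: "affine L" "aff_dim L = 1"
    using assms by (auto simp: is_line_def)
  have "L \<noteq> {c}" using L by auto
  then obtain b where b: "b \<in> L" "b \<noteq> c" using assms(2) by blast
  have sub: "affine hull {c, b} \<subseteq> L"
    using L b assms(2) by (simp add: hull_minimal)
  have "aff_dim (affine hull {c, b}) = 1"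
    using b by (simp add: aff_dim_2)
  then have eq: "affine hull {c, b} = L"
    using L sub by (intro affine_dim_equal) (auto simp: hull_inc)
  define e where "e = (b - c) /\<^sub>R norm (b - c)"
  have n: "norm e = 1" using b by (simp add: e_def)
  have "L = range (\<lambda>t. c + t *\<^sub>R e)"
  proof (intro subset_antisym subsetI)
    fix x assume "x \<in> L"
    then obtain u v where "x = u *\<^sub>R c + v *\<^sub>R b" "u + v = 1"
      unfolding eq[symmetric] affine_hull_2 mem_Collect_eq by blast
    moreover from this have "u = 1 - v" by simp
    ultimately have "x = c + (v * norm (b - c)) *\<^sub>R e"
      using b by (simp add: e_def algebra_simps)
    then show "x \<in> range (\<lambda>t. c + t *\<^sub>R e)" by blast
  next
    fix x assume "x \<in> range (\<lambda>t. c + t *\<^sub>R e)"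
    then obtain t where "x = c + t *\<^sub>R e" by blast
    then have "x = (1 - t / norm (b - c)) *\<^sub>R c + (t / norm (b - c)) *\<^sub>R b"
      by (simp add: e_def algebra_simps divide_inverse)
    then show "x \<in> L"
      unfolding eq[symmetric] affine_hull_2 mem_Collect_eq
      by (intro exI[of _ "1 - t / norm (b - c)"] exI[of _ "t / norm (b - c)"]) auto
  qed
  with n show ?thesis by (rule that)
qed

lemma rotated_line_range:
  "rotated_line c (range (\<lambda>t. c + t *\<^sub>R e)) \<phi> = range (\<lambda>t. c + t *\<^sub>R rot \<phi> e)"
  by (simp add: rotated_line_def image_image rot_scaleR)

lemma perpendicular_at_range:
  "perpendicular_at (range (\<lambda>s. P + s *\<^sub>R u)) P = {x. (x - P) \<bullet> u = 0}"
  unfolding perpendicular_at_def orthogonal_def by (auto dest: spec[of _ 1])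

section \<open>Uniqueness of tangents\<close>

text \<open>Caratheodory's form of the derivative factors the graph function as
  \<open>f s = s * q s\<close> with \<open>q\<close> continuous at 0 and \<open>q 0 = 0\<close>.
  Curve points then leave \<open>P\<close> in the secant direction
  \<open>u + q s *\<^sub>R v\<close>, which tends to \<open>u\<close>, and later limits concern only
  \<open>q\<close>.\<close>

lemma is_tangentE:
  assumes "is_tangent p \<gamma> P"
  obtains u v r S q where "norm u = 1" "norm v = 1" "u \<bullet> v = 0"
    "p = range (\<lambda>s. P + s *\<^sub>R u)" "r > 0" "0 \<in> interior S" "isCont q 0" "q 0 = (0::real)"
    "\<gamma> \<inter> ball P r = (\<lambda>s. P + s *\<^sub>R (u + q s *\<^sub>R v)) ` S"
proof -
  obtain u v r and S :: "real set" and f where *: "P \<in> \<gamma>" "norm u = 1" "norm v = 1" "u \<bullet> v = 0"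
    "p = range (\<lambda>s. P + s *\<^sub>R u)" "r > 0" "0 \<in> interior S" "(f has_real_derivative 0) (at 0)"
    "\<gamma> \<inter> ball P r = (\<lambda>s. P + s *\<^sub>R u + f s *\<^sub>R v) ` S"
    using assms unfolding is_tangent_def by blast
  \<comment> \<open>The curve passes through \<open>P\<close>, and comparing coordinates shows that
    it does so at abscissa 0. This yields \<open>f 0 = 0\<close>, which the definition does not
    demand explicitly.\<close>
  have "P \<in> \<gamma> \<inter> ball P r" using *(1,6) by simp
  then obtain s where s: "s *\<^sub>R u + f s *\<^sub>R v = 0"
    unfolding *(9) by (metis (no_types, lifting) add.assoc add_cancel_left_right imageE)
  have "(s *\<^sub>R u + f s *\<^sub>R v) \<bullet> u = s" "(s *\<^sub>R u + f s *\<^sub>R v) \<bullet> v = f s"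
    using *(2-4) by (simp_all add: inner_add_left inner_commute[of v u] norm_eq_1)
  then have f0: "f 0 = 0" using s by auto
  obtain q where q: "\<And>z. f z - f 0 = q z * (z - 0)" "isCont q 0" "q 0 = 0"
    using *(8) unfolding CARAT_DERIV by blast
  have "f s = s * q s" for s using q(1)[of s] f0 by simp
  then have "\<gamma> \<inter> ball P r = (\<lambda>s. P + s *\<^sub>R (u + q s *\<^sub>R v)) ` S"
    using *(9) by (simp add: scaleR_add_right add.assoc)
  with * q show ?thesis by (intro that[of u v r S q]) auto
qed

text \<open>In the plane the vectors orthogonal to \<open>v'\<close> form a single line, the one
  spanned by \<open>u'\<close>. Orthogonality to one normal thus identifies a direction up to a
  nonzero factor.\<close>

lemma orthonormal_pair_eq:
  fixes u u' v v' :: "real^2"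
  assumes "norm u = 1" "norm u' = 1" "norm v' = 1" "u' \<bullet> v' = 0" "u \<bullet> v' = 0"
  shows "u = (u \<bullet> u') *\<^sub>R u'" and "u \<bullet> u' \<noteq> 0"
proof -
  have v': "v' = (v' \<bullet> quarter_turn u') *\<^sub>R quarter_turn u'"
    using orthonormal_expansion[of u' v'] assms by (simp add: inner_commute)
  then have "v' \<bullet> quarter_turn u' \<noteq> 0" using assms(3) by auto
  moreover have "u \<bullet> v' = (v' \<bullet> quarter_turn u') * (u \<bullet> quarter_turn u')"
    by (subst v') simp
  ultimately have "u \<bullet> quarter_turn u' = 0" using assms by auto
  then show *: "u = (u \<bullet> u') *\<^sub>R u'"
    using orthonormal_expansion[of u' u] assms by simp
  then show "u \<bullet> u' \<noteq> 0" using assms(1) by auto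
qed

text \<open>The same curve points are read in both coordinate systems. Their secant directions tend
  to \<open>u\<close> by the first, while by the second their slope relative to \<open>u'\<close>
  tends to 0. Hence \<open>u\<close> is orthogonal to \<open>v'\<close> and both lines have the same
  direction. This makes the description in \<open>tangent_at\<close> well defined.\<close>

lemma is_tangent_unique:
  assumes "is_tangent p \<gamma> P" and "is_tangent p' \<gamma> P"
  shows "p = p'"
proof -
  obtain u v r S q where t: "norm u = 1" "norm v = 1" "u \<bullet> v = 0"
    "p = range (\<lambda>s. P + s *\<^sub>R u)" "r > 0" "0 \<in> interior S" "isCont q 0" "q 0 = 0"
    "\<gamma> \<inter> ball P r = (\<lambda>s. P + s *\<^sub>R (u + q s *\<^sub>R v)) ` S"
    using assms(1) by (rule is_tangentE)
  obtain u' v' r' S' q' where t': "norm u' = 1" "norm v' = 1" "u' \<bullet> v' = 0"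
    "p' = range (\<lambda>s. P + s *\<^sub>R u')" "r' > 0" "0 \<in> interior S'" "isCont q' 0" "q' 0 = 0"
    "\<gamma> \<inter> ball P r' = (\<lambda>s. P + s *\<^sub>R (u' + q' s *\<^sub>R v')) ` S'"
    using assms(2) by (rule is_tangentE)
  define w where "w s = u + q s *\<^sub>R v" for s
  \<comment> \<open>This is the abscissa, in the second system, of the curve point with abscissa
    \<open>s\<close> in the first.\<close>
  define s' where "s' s = s * (w s \<bullet> u')" for s
  have q: "(q \<longlongrightarrow> 0) (at 0)" using t(7,8) by (simp add: isCont_def)
  have w: "(w \<longlongrightarrow> u) (at 0)"
    unfolding w_def by (auto intro!: tendsto_eq_intros q)
  have s': "isCont s' 0" unfolding s'_def w_def using t(7) by (intro continuous_intros)
  have q': "((\<lambda>s. q' (s' s)) \<longlongrightarrow> 0) (at 0)"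
    using isCont_o2[OF s', of q'] t'(7,8) by (simp add: s'_def isCont_def)
  have "((\<lambda>s. P + s *\<^sub>R w s) \<longlongrightarrow> P) (at 0)"
    by (auto intro!: tendsto_eq_intros w)
  then have "\<forall>\<^sub>F s in at 0. P + s *\<^sub>R w s \<in> ball P r'"
    using t'(5) by (intro topological_tendstoD) auto
  moreover have "\<forall>\<^sub>F s in at 0. s \<in> S"
    using t(6) by (metis eventually_at_topological interior_subset open_interior subsetD)
  moreover have "\<forall>\<^sub>F s in at (0::real). s \<noteq> 0" by (simp add: eventually_at_filter)
  ultimately have ev: "\<forall>\<^sub>F s in at 0. w s \<bullet> v' = q' (s' s) * (w s \<bullet> u')"
  proof eventually_elim
    case (elim s)
    then have "P + s *\<^sub>R w s \<in> \<gamma> \<inter> ball P r" using t(9) by (auto simp: w_def)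
    then have "P + s *\<^sub>R w s \<in> \<gamma> \<inter> ball P r'" using elim by auto
    then obtain z where z: "s *\<^sub>R w s = z *\<^sub>R (u' + q' z *\<^sub>R v')" using t'(9) by auto
    have "z = (s *\<^sub>R w s) \<bullet> u'" "z * q' z = (s *\<^sub>R w s) \<bullet> v'"
      unfolding z using t'(1-3) by (simp_all add: inner_add_left inner_commute[of v' u'] norm_eq_1)
    then show ?case using elim by (auto simp: s'_def mult.commute)
  qed
  have "((\<lambda>s. q' (s' s) * (w s \<bullet> u')) \<longlongrightarrow> 0) (at 0)"
    by (auto intro!: tendsto_eq_intros q' w)
  moreover
  have "((\<lambda>s. w s \<bullet> v') \<longlongrightarrow> u \<bullet> v') (at 0)" by (intro tendsto_intros w)
  then have "((\<lambda>s. q' (s' s) * (w s \<bullet> u')) \<longlongrightarrow> u \<bullet> v') (at 0)"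
    using tendsto_cong[OF ev] by blast
  ultimately have "u \<bullet> v' = 0"
    by (intro tendsto_unique[OF at_neq_bot])
  from orthonormal_pair_eq[OF t(1) t'(1-3) this]
  obtain k where k: "u = k *\<^sub>R u'" "k \<noteq> 0" by blast
  have "range (\<lambda>s. P + s *\<^sub>R u') = range (\<lambda>s. P + s *\<^sub>R u)"
  proof (intro subset_antisym subsetI; elim rangeE)
    fix x s assume "x = P + s *\<^sub>R u'"
    then have "x = P + (s / k) *\<^sub>R u" using k by simp
    then show "x \<in> range (\<lambda>s. P + s *\<^sub>R u)" by blast
  next
    fix x s assume "x = P + s *\<^sub>R u"
    then have "x = P + (s * k) *\<^sub>R u'" using k by simp
    then show "x \<in> range (\<lambda>s. P + s *\<^sub>R u')" by blast
  qed
  then show ?thesis using t(4) t'(4) by simp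
qed

lemma tangent_at_eq: "is_tangent p \<gamma> P \<Longrightarrow> tangent_at \<gamma> P = p"
  unfolding tangent_at_def by (rule the_equality) (auto dest: is_tangent_unique)

section \<open>Derivative of the polar radius of a boundary point\<close>

text \<open>
  Near an end-point \<open>P\<close> of a chord through an interior point \<open>x\<close>, the cone with apex \<open>P\<close> over a
  ball around \<open>x\<close> lies in the interior, so it cannot contain the boundary curve.
\<close>
lemma tangent_transversal:
  fixes K :: "(real^2) set"
  assumes "convex K" "x \<in> interior K" "P \<in> K"
    and "norm v = 1" "r > 0" "0 \<in> interior S" "isCont q 0" "q 0 = 0"
    and curve: "frontier K \<inter> ball P r = (\<lambda>s. P + s *\<^sub>R (u + q s *\<^sub>R v)) ` S"
  shows "x - P \<noteq> m *\<^sub>R u"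
proof
  assume m: "x - P = m *\<^sub>R u"
  have "P \<in> frontier K"
  proof -
    have "0 \<in> S" using assms(6) interior_subset by blast
    then have "P + 0 *\<^sub>R (u + q 0 *\<^sub>R v) \<in> frontier K \<inter> ball P r" unfolding curve by (rule imageI)
    then show ?thesis by simp
  qed
  then have "m \<noteq> 0" using m assms(2) by (auto simp: frontier_def)
  obtain \<rho> where \<rho>: "\<rho> > 0" "ball x \<rho> \<subseteq> interior K"
    using openE[OF open_interior assms(2)] .
  have "isCont (\<lambda>t. q (t * m)) 0"
    by (rule isCont_o2[where f = "\<lambda>t. t * m" and g = q]) (simp_all add: assms(7))
  then have "((\<lambda>t. q (t * m)) \<longlongrightarrow> 0) (at 0)"
    by (simp add: isCont_def assms(8))
  then have "((\<lambda>t. q (t * m)) \<longlongrightarrow> 0) (at_right 0)"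
    by (simp add: filterlim_at_split)
  then have "((\<lambda>t. m * q (t * m)) \<longlongrightarrow> m * 0) (at_right 0)" by (intro tendsto_intros)
  then have "\<forall>\<^sub>F t in at_right 0. m * q (t * m) \<in> ball 0 \<rho>"
    using \<rho>(1) by (intro topological_tendstoD) auto
  moreover have "\<forall>\<^sub>F t in at_right (0::real). t * m \<in> interior S"
  proof -
    have "((\<lambda>t. t * m) \<longlongrightarrow> 0 * m) (at_right (0::real))" by (intro tendsto_intros)
    then show ?thesis using assms(6) by (intro topological_tendstoD) auto
  qed
  moreover have "\<forall>\<^sub>F t in at_right (0::real). t \<in> {0<..<1}"
    by (rule eventually_at_right_real) simp
  ultimately have "\<forall>\<^sub>F t in at_right 0.
      m * q (t * m) \<in> ball 0 \<rho> \<and> t * m \<in> interior S \<and> t \<in> {0<..<1}"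
    by (intro eventually_conj)
  from eventually_happens[OF this] obtain t
    where t: "m * q (t * m) \<in> ball 0 \<rho>" "t * m \<in> interior S" "t \<in> {0<..<1}"
    by auto
  \<comment> \<open>Chosen so that the curve point with parameter \<open>t * m\<close> is exactly
    \<open>P + t *\<^sub>R (y - P)\<close>, a point of the cone. The choice of \<open>t\<close>
    keeps \<open>y\<close> in the ball around \<open>x\<close>.\<close>
  define y where "y = x + (m * q (t * m)) *\<^sub>R v"
  have "y \<in> interior K"
    using t(1) \<rho>(2) assms(4) by (auto simp: y_def dist_norm)
  then have "P - t *\<^sub>R (P - y) \<in> interior K"
    using t(3) by (intro mem_interior_convex_shrink assms(1,3)) auto
  moreover have "P - t *\<^sub>R (P - y) = P + (t * m) *\<^sub>R (u + q (t * m) *\<^sub>R v)"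
  proof -
    have "x = P + m *\<^sub>R u" using m by (simp add: algebra_simps)
    then show ?thesis by (simp add: y_def algebra_simps)
  qed
  moreover have "P + (t * m) *\<^sub>R (u + q (t * m) *\<^sub>R v) \<in> frontier K"
    using t(2) curve interior_subset by blast
  ultimately show False by (simp add: frontier_def)
qed

text \<open>
  Comparing components along \<open>rot \<psi> e\<close> and its quarter turn eliminates the parameter of the curve.
\<close>
lemma polar_radius_has_derivative:
  fixes a :: "real \<Rightarrow> real" and c :: "real^2"
  assumes e: "norm e = 1" and "isCont a \<phi>"
    and P: "P = c + a \<phi> *\<^sub>R rot \<phi> e"
    and on: "\<forall>\<^sub>F \<psi> in at \<phi>. c + a \<psi> *\<^sub>R rot \<psi> e \<in> \<gamma>"
    and "norm u = 1" "norm v = 1" "u \<bullet> v = 0" "r > 0" "isCont q 0" "q 0 = 0"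
    and curve: "\<gamma> \<inter> ball P r = (\<lambda>s. P + s *\<^sub>R (u + q s *\<^sub>R v)) ` S"
    and transv: "u \<bullet> quarter_turn (rot \<phi> e) \<noteq> 0"
  shows "(a has_real_derivative
      a \<phi> * ((u \<bullet> rot \<phi> e) / (u \<bullet> quarter_turn (rot \<phi> e)))) (at \<phi>)"
proof -
  define A where "A \<psi> = c + a \<psi> *\<^sub>R rot \<psi> e" for \<psi>
  \<comment> \<open>The curve parameter of \<open>A \<psi>\<close> is its component along
    \<open>u\<close> relative to \<open>P\<close>, so \<open>w \<psi>\<close> is the secant
    direction from \<open>P\<close> to \<open>A \<psi>\<close>, up to scaling.\<close>
  define w where "w \<psi> = u + q ((A \<psi> - P) \<bullet> u) *\<^sub>R v" for \<psi>
  define R where "R \<psi> = (w \<psi> \<bullet> rot \<psi> e) / (w \<psi> \<bullet> quarter_turn (rot \<psi> e))" for \<psi>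
  have ee: "e \<bullet> e = 1" using e by (simp add: norm_eq_1)
  have AP: "A \<phi> = P" by (simp add: A_def P)
  have A: "(A \<longlongrightarrow> P) (at \<phi>)"
    unfolding A_def P using assms(2) by (intro tendsto_intros tendsto_rot) (simp add: isCont_def)
  have "isCont (\<lambda>\<psi>. (A \<psi> - P) \<bullet> u) \<phi>"
    unfolding isCont_def AP by (intro tendsto_intros A)
  then have "isCont (\<lambda>\<psi>. q ((A \<psi> - P) \<bullet> u)) \<phi>"
    by (rule isCont_o2[where g = q]) (simp add: AP assms(9))
  then have "((\<lambda>\<psi>. q ((A \<psi> - P) \<bullet> u)) \<longlongrightarrow> 0) (at \<phi>)"
    by (simp add: isCont_def AP assms(10))
  then have w: "(w \<longlongrightarrow> u) (at \<phi>)"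
    unfolding w_def by (auto intro!: tendsto_eq_intros)
  have wn: "((\<lambda>\<psi>. w \<psi> \<bullet> quarter_turn (rot \<psi> e)) \<longlongrightarrow> u \<bullet> quarter_turn (rot \<phi> e)) (at \<phi>)"
    by (intro tendsto_intros w tendsto_quarter_turn tendsto_rot)
  have R\<phi>: "R \<phi> = (u \<bullet> rot \<phi> e) / (u \<bullet> quarter_turn (rot \<phi> e))"
    by (simp add: R_def w_def AP assms(10))
  have R: "isCont R \<phi>"
    unfolding isCont_def R\<phi> unfolding R_def
    by (intro tendsto_intros wn w tendsto_rot transv)
  have "\<forall>\<^sub>F \<psi> in at \<phi>. A \<psi> \<in> ball P r"
    using A assms(8) by (intro topological_tendstoD) auto
  moreover have "\<forall>\<^sub>F \<psi> in at \<phi>. w \<psi> \<bullet> quarter_turn (rot \<psi> e) \<noteq> 0"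
    using wn transv by (rule tendsto_imp_eventually_ne)
  \<comment> \<open>An exact identity rather than an estimate: the secant parameter cancels when the
    component along the ray is divided by the transversal one. The only quantity left that depends
    on the curve is \<open>R\<close>.\<close>
  ultimately have ev: "\<forall>\<^sub>F \<psi> in at \<phi>. a \<psi> = a \<phi> * cos (\<psi> - \<phi>) + a \<phi> * (sin (\<psi> - \<phi>) * R \<psi>)"
    using on
  proof eventually_elim
    case (elim \<psi>)
    then have "A \<psi> \<in> \<gamma> \<inter> ball P r" by (simp add: A_def)
    then obtain s where s: "A \<psi> = P + s *\<^sub>R (u + q s *\<^sub>R v)" using curve by auto
    have su: "(A \<psi> - P) \<bullet> u = s"
      using assms(5-7) by (simp add: s inner_add_left inner_commute[of v u] norm_eq_1)
    have s: "A \<psi> - P = s *\<^sub>R w \<psi>" unfolding w_def su using s by simp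
    have AP': "A \<psi> - P = a \<psi> *\<^sub>R rot \<psi> e - a \<phi> *\<^sub>R rot \<phi> e" by (simp add: A_def P)
    have "(A \<psi> - P) \<bullet> quarter_turn (rot \<psi> e) = a \<phi> * sin (\<psi> - \<phi>)"
      unfolding AP' inner_diff_left inner_scaleR_left inner_rot_quarter_turn_rot ee
      by (simp add: sin_diff algebra_simps)
    then have 1: "s * (w \<psi> \<bullet> quarter_turn (rot \<psi> e)) = a \<phi> * sin (\<psi> - \<phi>)" using s by simp
    have "(A \<psi> - P) \<bullet> rot \<psi> e = a \<psi> - a \<phi> * cos (\<psi> - \<phi>)"
      unfolding AP' inner_diff_left inner_scaleR_left inner_rot_rot ee
      by (simp add: cos_diff algebra_simps)
    then have 2: "s * (w \<psi> \<bullet> rot \<psi> e) = a \<psi> - a \<phi> * cos (\<psi> - \<phi>)" using s by simp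
    have "a \<phi> * (sin (\<psi> - \<phi>) * R \<psi>) = s * (w \<psi> \<bullet> quarter_turn (rot \<psi> e)) * R \<psi>"
      using 1 by simp
    also have "\<dots> = a \<psi> - a \<phi> * cos (\<psi> - \<phi>)" using elim 2 by (simp add: R_def)
    finally show ?case by simp
  qed
  have "((\<lambda>\<psi>. sin (\<psi> - \<phi>)) has_real_derivative 1) (at \<phi>)"
    by (auto intro!: derivative_eq_intros)
  then obtain g where g: "\<And>z. sin (z - \<phi>) = g z * (z - \<phi>)" "isCont g \<phi>" "g \<phi> = 1"
    unfolding CARAT_DERIV by auto
  \<comment> \<open>Only continuity of \<open>R\<close> at \<open>\<phi>\<close> is known. It
    suffices because the other factor, the sine, vanishes there.\<close>
  have sinR: "((\<lambda>\<psi>. sin (\<psi> - \<phi>) * R \<psi>) has_real_derivative R \<phi>) (at \<phi>)"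
    unfolding CARAT_DERIV using g R by (intro exI[of _ "\<lambda>z. g z * R z"]) auto
  have "((\<lambda>\<psi>. a \<phi> * cos (\<psi> - \<phi>)) has_real_derivative 0) (at \<phi>)"
    by (auto intro!: derivative_eq_intros)
  from DERIV_add[OF this DERIV_cmult[OF sinR, of "a \<phi>"]]
  have "((\<lambda>\<psi>. a \<phi> * cos (\<psi> - \<phi>) + a \<phi> * (sin (\<psi> - \<phi>) * R \<psi>)) has_real_derivative a \<phi> * R \<phi>)
      (at \<phi>)"
    by simp
  moreover have "\<forall>\<^sub>F \<psi> in nhds \<phi>. a \<psi> = a \<phi> * cos (\<psi> - \<phi>) + a \<phi> * (sin (\<psi> - \<phi>) * R \<psi>)"
    using ev by (simp add: eventually_nhds_conv_at)
  ultimately show ?thesis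
    unfolding R\<phi>[symmetric] by (simp add: DERIV_cong_ev[OF refl _ refl])
qed

text \<open>The interior point at \<open>t0\<close> provides both continuity of the end and
  transversality of its tangent. Only the upper end is treated and no sign is imposed on
  \<open>t0\<close> or \<open>a\<close>: replacing \<open>e\<close> by \<open>- e\<close> turns the
  lower end into an upper one.\<close>

lemma section_end_derivative:
  fixes a b :: "real \<Rightarrow> real" and K :: "(real^2) set"
  assumes K: "closed K" "convex K" "smooth_boundary K" and e: "norm e = 1"
    and sec: "\<forall>\<^sub>F \<psi> in nhds \<phi>. {t. c + t *\<^sub>R rot \<psi> e \<in> K} = {b \<psi>..a \<psi>}"
    and int: "c + t0 *\<^sub>R rot \<phi> e \<in> interior K"
    and P: "P = c + a \<phi> *\<^sub>R rot \<phi> e"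
  obtains u where "tangent_at (frontier K) P = range (\<lambda>s. P + s *\<^sub>R u)"
    "u \<bullet> quarter_turn (rot \<phi> e) \<noteq> 0"
    "(a has_real_derivative
      a \<phi> * ((u \<bullet> rot \<phi> e) / (u \<bullet> quarter_turn (rot \<phi> e)))) (at \<phi>)"
proof -
  have point: "((\<lambda>\<psi>. c + t *\<^sub>R rot \<psi> e) \<longlongrightarrow> c + t *\<^sub>R rot \<phi> e) (at \<phi>)" for t
    by (intro tendsto_intros tendsto_rot)
  have near: "\<forall>\<^sub>F \<psi> in at \<phi>. c + t *\<^sub>R rot \<psi> e \<in> U" if "open U" "c + t *\<^sub>R rot \<phi> e \<in> U" for t U
    using point that by (rule topological_tendstoD)
  have sec': "\<forall>\<^sub>F \<psi> in at \<phi>. {t. c + t *\<^sub>R rot \<psi> e \<in> K} = {b \<psi>..a \<psi>}"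
    using sec by (simp add: eventually_nhds_conv_at)
  have sec\<phi>: "c + t *\<^sub>R rot \<phi> e \<in> K \<longleftrightarrow> t \<in> {b \<phi>..a \<phi>}" for t
    using eventually_nhds_x_imp_x[OF sec] by blast
  \<comment> \<open>If the end were interior, parameters slightly beyond \<open>a \<psi>\<close>
    would still give points of \<open>K\<close>.\<close>
  have not_int: "c + a \<psi> *\<^sub>R rot \<psi> e \<notin> interior K" if "{t. c + t *\<^sub>R rot \<psi> e \<in> K} = {b \<psi>..a \<psi>}" for \<psi>
  proof
    assume "c + a \<psi> *\<^sub>R rot \<psi> e \<in> interior K"
    moreover have "((\<lambda>t. c + t *\<^sub>R rot \<psi> e) \<longlongrightarrow> c + a \<psi> *\<^sub>R rot \<psi> e) (at_right (a \<psi>))"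
      by (intro tendsto_intros)
    ultimately have "\<forall>\<^sub>F t in at_right (a \<psi>). c + t *\<^sub>R rot \<psi> e \<in> interior K"
      by (intro topological_tendstoD) auto
    moreover have "\<forall>\<^sub>F t in at_right (a \<psi>). t > a \<psi>" by (simp add: eventually_at_filter)
    ultimately have "\<forall>\<^sub>F t in at_right (a \<psi>). False"
    proof eventually_elim
      case (elim t)
      then have "t \<in> {b \<psi>..a \<psi>}" using that interior_subset by blast
      then show False using elim by simp
    qed
    then show False by simp
  qed
  have t0K: "t0 \<in> {b \<phi>..a \<phi>}" using int interior_subset sec\<phi> by blast
  moreover have "t0 \<noteq> a \<phi>"
    using not_int[OF eventually_nhds_x_imp_x[OF sec]] int by auto
  ultimately have t0: "b \<phi> \<le> t0" "t0 < a \<phi>" by auto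
  have PK: "P \<in> K" using sec\<phi>[of "a \<phi>"] t0 P by simp
  have t0_near: "\<forall>\<^sub>F \<psi> in at \<phi>. t0 \<in> {b \<psi>..a \<psi>}"
    using near[OF open_interior int] sec'
  proof eventually_elim
    case (elim \<psi>)
    then show ?case using interior_subset by blast
  qed
  have "isCont a \<phi>"
    unfolding isCont_def
  proof (rule order_tendstoI)
    fix y assume y: "y < a \<phi>"
    \<comment> \<open>The point with parameter \<open>t\<close> lies strictly between an interior
      point and \<open>P\<close>, hence is interior. It therefore stays in \<open>K\<close> for
      nearby angles and bounds \<open>a \<psi>\<close> from below.\<close>
    obtain t where t: "max y t0 < t" "t < a \<phi>" using y t0 dense[of "max y t0"] by auto
    define k where "k = (a \<phi> - t) / (a \<phi> - t0)"
    have k: "0 < k" "k \<le> 1" "k * (a \<phi> - t0) = a \<phi> - t" using t t0 by (auto simp: k_def)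
    have "P - k *\<^sub>R (P - (c + t0 *\<^sub>R rot \<phi> e)) \<in> interior K"
      using k by (intro mem_interior_convex_shrink K int PK)
    moreover have "P - k *\<^sub>R (P - (c + t0 *\<^sub>R rot \<phi> e)) = c + (a \<phi> - k * (a \<phi> - t0)) *\<^sub>R rot \<phi> e"
      by (simp add: P algebra_simps)
    ultimately have "c + t *\<^sub>R rot \<phi> e \<in> interior K" using k by simp
    from near[OF open_interior this] sec' show "\<forall>\<^sub>F \<psi> in at \<phi>. y < a \<psi>"
    proof eventually_elim
      case (elim \<psi>)
      then have "t \<in> {b \<psi>..a \<psi>}" using interior_subset by blast
      then show ?case using t by auto
    qed
  next
    fix y assume y: "a \<phi> < y"
    then have "c + y *\<^sub>R rot \<phi> e \<in> - K" using sec\<phi> by auto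
    with K(1) have "\<forall>\<^sub>F \<psi> in at \<phi>. c + y *\<^sub>R rot \<psi> e \<in> - K" by (intro near) auto
    \<comment> \<open>Nearby sections are intervals that contain \<open>t0\<close> and miss
      \<open>y\<close>. Since \<open>t0 < y\<close>, they end before \<open>y\<close>.\<close>
    then show "\<forall>\<^sub>F \<psi> in at \<phi>. a \<psi> < y" using sec' t0_near
    proof eventually_elim
      case (elim \<psi>)
      then have "y \<notin> {b \<psi>..a \<psi>}" by blast
      then show ?case using elim y t0 by auto
    qed
  qed
  have fr: "c + a \<psi> *\<^sub>R rot \<psi> e \<in> frontier K"
    if "{t. c + t *\<^sub>R rot \<psi> e \<in> K} = {b \<psi>..a \<psi>}" "t0 \<in> {b \<psi>..a \<psi>}" for \<psi>
  proof -
    have "a \<psi> \<in> {b \<psi>..a \<psi>}" using that by auto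
    then have "c + a \<psi> *\<^sub>R rot \<psi> e \<in> K" using that(1) by blast
    then show ?thesis using not_int[OF that(1)] K(1) by (simp add: frontier_def)
  qed
  have on: "\<forall>\<^sub>F \<psi> in at \<phi>. c + a \<psi> *\<^sub>R rot \<psi> e \<in> frontier K"
    using sec' t0_near by eventually_elim (rule fr)
  have "P \<in> frontier K"
    unfolding P using eventually_nhds_x_imp_x[OF sec] t0K by (rule fr)
  then obtain p where p: "is_tangent p (frontier K) P" using K by (auto simp: smooth_boundary_def)
  then obtain u v r S q where t: "norm u = 1" "norm v = 1" "u \<bullet> v = 0"
    "p = range (\<lambda>s. P + s *\<^sub>R u)" "r > 0" "0 \<in> interior S" "isCont q 0" "q 0 = 0"
    "frontier K \<inter> ball P r = (\<lambda>s. P + s *\<^sub>R (u + q s *\<^sub>R v)) ` S"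
    by (rule is_tangentE)
  \<comment> \<open>Otherwise \<open>u\<close> would be parallel to the chord, and the vector from
    \<open>P\<close> to the interior point would be a multiple of \<open>u\<close>.\<close>
  have transv: "u \<bullet> quarter_turn (rot \<phi> e) \<noteq> 0"
  proof
    assume "u \<bullet> quarter_turn (rot \<phi> e) = 0"
    with orthonormal_pair_eq[of u "rot \<phi> e" "quarter_turn (rot \<phi> e)"] t(1) e
    have "u = (u \<bullet> rot \<phi> e) *\<^sub>R rot \<phi> e" "u \<bullet> rot \<phi> e \<noteq> 0" by auto
    then obtain k where k: "u = k *\<^sub>R rot \<phi> e" "k \<noteq> 0" by blast
    have "(c + t0 *\<^sub>R rot \<phi> e) - P = (t0 - a \<phi>) *\<^sub>R rot \<phi> e"
      by (simp add: P algebra_simps)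
    also have "\<dots> = ((t0 - a \<phi>) / k) *\<^sub>R u" using k by simp
    finally have "(c + t0 *\<^sub>R rot \<phi> e) - P = ((t0 - a \<phi>) / k) *\<^sub>R u" .
    then show False
      using tangent_transversal[OF K(2) int PK t(2,5-9)] by blast
  qed
  show ?thesis
  proof (rule that)
    show "tangent_at (frontier K) P = range (\<lambda>s. P + s *\<^sub>R u)"
      using tangent_at_eq[OF p] t(4) by simp
    show "u \<bullet> quarter_turn (rot \<phi> e) \<noteq> 0" by (rule transv)
    show "(a has_real_derivative
      a \<phi> * ((u \<bullet> rot \<phi> e) / (u \<bullet> quarter_turn (rot \<phi> e)))) (at \<phi>)"
      by (rule polar_radius_has_derivative[OF e \<open>isCont a \<phi>\<close> P on t(1-3,5,7-9) transv])
  qed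
qed

section \<open>Chords as parameter intervals\<close>

lemma closed_segment_ray:
  fixes c e :: "'a::real_vector"
  shows "closed_segment (c + a *\<^sub>R e) (c + b *\<^sub>R e) = (\<lambda>t. c + t *\<^sub>R e) ` closed_segment a b"
proof -
  have "(1 - k) *\<^sub>R (c + a *\<^sub>R e) + k *\<^sub>R (c + b *\<^sub>R e) = c + ((1 - k) *\<^sub>R a + k *\<^sub>R b) *\<^sub>R e" for k :: real
    by (simp add: algebra_simps)
  then show ?thesis unfolding closed_segment_def by (auto simp: image_iff)
qed

lemma chord_dom_section:
  assumes "norm e = 1" and "\<phi> \<in> chord_dom c (range (\<lambda>t. c + t *\<^sub>R e)) K"
  obtains a b where "b \<le> a" "{t. c + t *\<^sub>R rot \<phi> e \<in> K} = {b..a}"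
proof -
  have inj: "c + s *\<^sub>R rot \<phi> e = c + t *\<^sub>R rot \<phi> e \<longleftrightarrow> s = t" for s t
    using rot_nonzero[OF assms(1)] by simp
  obtain A B where AB: "range (\<lambda>t. c + t *\<^sub>R rot \<phi> e) \<inter> K = closed_segment A B"
    using assms(2) by (auto simp: chord_dom_def rotated_line_range)
  then obtain x y where "A = c + x *\<^sub>R rot \<phi> e" "B = c + y *\<^sub>R rot \<phi> e"
    by (metis (no_types, lifting) IntE ends_in_segment rangeE)
  then have seg: "range (\<lambda>t. c + t *\<^sub>R rot \<phi> e) \<inter> K = (\<lambda>t. c + t *\<^sub>R rot \<phi> e) ` closed_segment x y"
    using AB closed_segment_ray by metis
  have "c + t *\<^sub>R rot \<phi> e \<in> K \<longleftrightarrow> c + t *\<^sub>R rot \<phi> e \<in> range (\<lambda>t. c + t *\<^sub>R rot \<phi> e) \<inter> K" for t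
    by blast
  then have "{t. c + t *\<^sub>R rot \<phi> e \<in> K} = closed_segment x y"
    unfolding seg using inj by auto
  also have "\<dots> = {min x y..max x y}" by (auto simp: closed_segment_eq_real_ivl)
  finally show ?thesis by (intro that[of "min x y" "max x y"]) auto
qed

text \<open>A segment determines its ends up to order, and \<open>0 < b\<close> places the whole
  chord on the positive ray, so the order is fixed by distance from \<open>c\<close>. This evaluates
  the definite descriptions of both ends.\<close>

lemma is_chord_iff:
  assumes e: "norm e = 1" and sec: "{t. c + t *\<^sub>R rot \<phi> e \<in> K} = {b..a}" and "0 < b" "b \<le> a"
  shows "is_chord c (range (\<lambda>t. c + t *\<^sub>R e)) K \<phi> A B \<longleftrightarrow>
    A = c + a *\<^sub>R rot \<phi> e \<and> B = c + b *\<^sub>R rot \<phi> e"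
proof -
  let ?r = "\<lambda>t. c + t *\<^sub>R rot \<phi> e"
  have seg: "range ?r \<inter> K = closed_segment (?r a) (?r b)"
  proof -
    have "range ?r \<inter> K = ?r ` {t. ?r t \<in> K}" by blast
    also have "\<dots> = ?r ` closed_segment a b"
      unfolding sec using assms by (auto simp: closed_segment_eq_real_ivl)
    finally show ?thesis by (simp add: closed_segment_ray)
  qed
  have inc: "?r b \<in> closed_segment c (?r a)"
    using closed_segment_ray[of c 0 "rot \<phi> e" a] assms(3,4) by (auto simp: closed_segment_eq_real_ivl)
  show ?thesis
  proof
    assume "is_chord c (range (\<lambda>t. c + t *\<^sub>R e)) K \<phi> A B"
    then have "closed_segment A B = closed_segment (?r a) (?r b)" and B: "B \<in> closed_segment c A"
      using seg by (auto simp: is_chord_def rotated_line_range)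
    then have "{A, B} = {?r a, ?r b}" by simp
    then have "A = ?r a \<and> B = ?r b \<or> A = ?r b \<and> B = ?r a" by (auto simp: doubleton_eq_iff)
    \<comment> \<open>In the swapped labelling the near end would be at distance \<open>a\<close>
      and the far end at distance \<open>b\<close>, which forces \<open>a = b\<close>. A degenerate
      chord is thus covered.\<close>
    moreover have "A = ?r a \<and> B = ?r b" if AB: "A = ?r b" "B = ?r a"
    proof -
      have "dist c B \<le> dist c A" using B dist_in_closed_segment by (metis dist_commute)
      then have "a \<le> b" using AB assms by (simp add: dist_norm)
      then show ?thesis using AB assms(4) by simp
    qed
    ultimately show "A = ?r a \<and> B = ?r b" by blast
  next
    assume "A = ?r a \<and> B = ?r b"
    then show "is_chord c (range (\<lambda>t. c + t *\<^sub>R e)) K \<phi> A B"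
      using seg inc by (simp add: is_chord_def rotated_line_range)
  qed
qed

lemma chord_ends:
  assumes "norm e = 1" and "{t. c + t *\<^sub>R rot \<phi> e \<in> K} = {b..a}" and "0 < b" "b \<le> a"
  shows "far_end c (range (\<lambda>t. c + t *\<^sub>R e)) K \<phi> = c + a *\<^sub>R rot \<phi> e"
    and "near_end c (range (\<lambda>t. c + t *\<^sub>R e)) K \<phi> = c + b *\<^sub>R rot \<phi> e"
    and "chord_length c (range (\<lambda>t. c + t *\<^sub>R e)) K \<phi> = a - b"
proof -
  note iff = is_chord_iff[OF assms]
  show f: "far_end c (range (\<lambda>t. c + t *\<^sub>R e)) K \<phi> = c + a *\<^sub>R rot \<phi> e"
    unfolding far_end_def iff by blast
  show n: "near_end c (range (\<lambda>t. c + t *\<^sub>R e)) K \<phi> = c + b *\<^sub>R rot \<phi> e"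
    unfolding near_end_def iff by blast
  show "chord_length c (range (\<lambda>t. c + t *\<^sub>R e)) K \<phi> = a - b"
    unfolding chord_length_def f n using assms by (simp add: dist_norm)
qed

section \<open>Lines at interior angles of the domain meet the interior\<close>

text \<open>The segment from \<open>x\<close> to \<open>y\<close> might run inside the boundary. An
  interior point \<open>q\<close> off the line is instead joined to whichever of \<open>x\<close>
  and \<open>y\<close> lies on the other side; every point of that segment, except possibly its end
  at \<open>x\<close> or \<open>y\<close>, is interior.\<close>

lemma convex_interior_zero:
  fixes K :: "'a::euclidean_space set"
  assumes "convex K" "interior K \<noteq> {}" "x \<in> K" "n \<bullet> (x - c) < 0" "y \<in> K" "n \<bullet> (y - c) > 0"
  obtains z where "z \<in> interior K" "n \<bullet> (z - c) = 0"
proof -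
  have main: "\<exists>z \<in> interior K. n \<bullet> (z - c) = 0" if x: "x \<in> K" "n \<bullet> (x - c) * (n \<bullet> (q - c)) < 0" and q: "q \<in> interior K" for x q
  proof -
    \<comment> \<open>The position on the segment from \<open>x\<close> to \<open>q\<close> at which
      the affine function vanishes.\<close>
    define k where "k = (n \<bullet> (x - c)) / (n \<bullet> (x - c) - n \<bullet> (q - c))"
    have ne: "n \<bullet> (x - c) - n \<bullet> (q - c) \<noteq> 0"
      using x(2) by (metis eq_iff_diff_eq_0 not_square_less_zero)
    have "0 < k" "k \<le> 1"
      using x(2) by (auto simp: k_def zero_less_divide_iff divide_le_eq_1 mult_less_0_iff)
    then have "x - k *\<^sub>R (x - q) \<in> interior K"
      by (intro mem_interior_convex_shrink assms(1) q x(1))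
    moreover have "n \<bullet> (x - k *\<^sub>R (x - q) - c) = 0"
    proof -
      have "n \<bullet> (x - k *\<^sub>R (x - q) - c) = n \<bullet> (x - c) - k * (n \<bullet> (x - c) - n \<bullet> (q - c))"
      by (simp add: inner_diff_right algebra_simps)
      then show ?thesis using ne by (simp add: k_def)
    qed
    ultimately show ?thesis by blast
  qed
  obtain q where q: "q \<in> interior K" using assms(2) by blast
  consider "n \<bullet> (q - c) = 0" | "n \<bullet> (q - c) > 0" | "n \<bullet> (q - c) < 0" by linarith
  then show thesis
  proof cases
    case 1 then show ?thesis using that q by blast
  next
    case 2 then show ?thesis using main[OF assms(3) _ q] assms(4) that by (auto simp: mult_neg_pos)
  next
    case 3 then show ?thesis using main[OF assms(5) _ q] assms(6) that by (auto simp: mult_pos_neg)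
  qed
qed

text \<open>
  If the negative ray of a slightly rotated line met \<open>K\<close>, joining that point to the given point
  \<open>c + t0 *\<^sub>R rot \<phi> e\<close> would produce points of \<open>K\<close> at distance at most \<open>t0 * tan \<bar>\<delta>\<bar>\<close> from \<open>c\<close>.
\<close>
lemma rotated_section_positive:
  fixes K :: "(real^2) set"
  assumes "closed K" "convex K" "c \<notin> K" "norm e = 1"
    and A: "c + t0 *\<^sub>R rot \<phi> e \<in> K" "t0 > 0"
  shows "\<forall>\<^sub>F \<delta> in nhds 0. \<forall>t. c + t *\<^sub>R rot (\<phi> + \<delta>) e \<in> K \<longrightarrow> t > 0"
proof -
  obtain \<rho> where \<rho>: "\<rho> > 0" "ball c \<rho> \<subseteq> - K"
    using assms(1,3) open_contains_ball[of "- K"] by auto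
  have "((\<lambda>\<delta>::real. t0 * \<bar>sin \<delta> / cos \<delta>\<bar>) \<longlongrightarrow> t0 * \<bar>sin 0 / cos 0\<bar>) (nhds 0)"
    by (intro tendsto_intros filterlim_ident) simp_all
  then have "\<forall>\<^sub>F \<delta> in nhds 0. t0 * \<bar>sin \<delta> / cos \<delta>\<bar> < \<rho>"
    using \<rho>(1) by (intro order_tendstoD(2)) auto
  moreover have "((\<lambda>\<delta>::real. cos \<delta>) \<longlongrightarrow> cos 0) (nhds 0)"
    by (intro tendsto_intros filterlim_ident)
  then have "\<forall>\<^sub>F \<delta>::real in nhds 0. cos \<delta> > 0" by (rule order_tendstoD(1)) simp
  ultimately show ?thesis
  proof eventually_elim
    case (elim \<delta>)
    show ?case
    proof (intro allI impI, rule ccontr)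
      fix t assume t: "c + t *\<^sub>R rot (\<phi> + \<delta>) e \<in> K" "\<not> t > 0"
      define m where "m = - t * cos \<delta>"
      have m: "m \<ge> 0" using t(2) elim by (simp add: m_def mult_nonpos_nonneg)
      have rot: "rot (\<phi> + \<delta>) e = cos \<delta> *\<^sub>R rot \<phi> e + sin \<delta> *\<^sub>R quarter_turn (rot \<phi> e)"
        by (simp add: vec_eq_iff forall_2 sin_add cos_add algebra_simps)
      \<comment> \<open>The weights cancel the component along \<open>rot \<phi> e\<close>: the two
        points have components \<open>t0\<close> and \<open>- m\<close> in that direction. What
        remains is orthogonal to it.\<close>
      define y where "y = (m / (t0 + m)) *\<^sub>R (c + t0 *\<^sub>R rot \<phi> e)
          + (t0 / (t0 + m)) *\<^sub>R (c + t *\<^sub>R rot (\<phi> + \<delta>) e)"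
      have "y \<in> K"
        unfolding y_def using m A(2)
        by (intro convexD[OF assms(2) A(1) t(1)]) (auto simp: add_divide_distrib[symmetric])
      have "t0 + m \<noteq> 0" using m A(2) by simp
      then have co: "m / (t0 + m) + t0 / (t0 + m) = 1"
        by (simp add: add_divide_distrib[symmetric] add.commute)
      have co': "(m / (t0 + m)) * t0 + (t0 / (t0 + m)) * (t * cos \<delta>) = 0"
        by (simp add: m_def add_divide_distrib[symmetric])
      have "y = (m / (t0 + m) + t0 / (t0 + m)) *\<^sub>R c
          + ((m / (t0 + m)) * t0 + (t0 / (t0 + m)) * (t * cos \<delta>)) *\<^sub>R rot \<phi> e
          + ((t0 / (t0 + m)) * (t * sin \<delta>)) *\<^sub>R quarter_turn (rot \<phi> e)"
        unfolding y_def rot by (simp only: scaleR_add_right scaleR_add_left scaleR_scaleR mult.assoc add.assoc add.left_commute)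
      then have "y - c = ((t0 / (t0 + m)) * (t * sin \<delta>)) *\<^sub>R quarter_turn (rot \<phi> e)"
        unfolding co co' by simp
      then have "norm (y - c) = \<bar>(t0 / (t0 + m)) * (t * sin \<delta>)\<bar>" using assms(4) by simp
      \<comment> \<open>For \<open>t \<le> 0\<close> and a positive cosine, the absolute value of
        \<open>t * sin \<delta>\<close> is \<open>m\<close> times that of the tangent of
        \<open>\<delta>\<close>.\<close>
      also have "\<dots> = t0 * \<bar>sin \<delta> / cos \<delta>\<bar> * (m / (t0 + m))"
        using m A(2) elim t(2) by (simp add: m_def abs_mult field_simps)
      also have "\<dots> \<le> t0 * \<bar>sin \<delta> / cos \<delta>\<bar> * 1"
        using m A(2) by (intro mult_left_mono) auto
      also have "\<dots> < \<rho>" using elim by simp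
      finally have "y \<in> ball c \<rho>" by (simp add: dist_norm norm_minus_commute)
      then show False using \<rho>(2) \<open>y \<in> K\<close> by blast
    qed
  qed
qed

lemma chord_dom_interior_meets_interior:
  fixes K :: "(real^2) set"
  assumes K: "closed K" "convex K" "interior K \<noteq> {}" "c \<notin> K" and e: "norm e = 1"
    and \<phi>: "\<phi> \<in> interior (chord_dom c (range (\<lambda>t. c + t *\<^sub>R e)) K)"
    and A: "c + t0 *\<^sub>R rot \<phi> e \<in> K" "t0 > 0"
  obtains t where "t > 0" "c + t *\<^sub>R rot \<phi> e \<in> interior K"
proof -
  let ?D = "chord_dom c (range (\<lambda>t. c + t *\<^sub>R e)) K"
  have ee: "e \<bullet> e = 1" using e by (simp add: norm_eq_1)
  have pos: "\<forall>\<^sub>F \<delta> in nhds 0. \<forall>t. c + t *\<^sub>R rot (\<phi> + \<delta>) e \<in> K \<longrightarrow> t > 0"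
    by (rule rotated_section_positive[OF K(1,2,4) e A])
  have shift: "((\<lambda>\<delta>. \<phi> + \<delta>) \<longlongrightarrow> \<phi> + 0) (nhds 0)" by (intro tendsto_intros filterlim_ident)
  have "\<forall>\<^sub>F \<delta> in nhds 0. \<phi> + \<delta> \<in> interior ?D"
    using shift by (rule topological_tendstoD) (use \<phi> in auto)
  with pos have "\<forall>\<^sub>F \<delta> in nhds 0. \<exists>t>0. c + t *\<^sub>R rot (\<phi> + \<delta>) e \<in> K"
  proof eventually_elim
    case (elim \<delta>)
    then have "\<phi> + \<delta> \<in> ?D" using interior_subset by blast
    then obtain a b where "b \<le> a" "{t. c + t *\<^sub>R rot (\<phi> + \<delta>) e \<in> K} = {b..a}"
      by (rule chord_dom_section[OF e])
    then have "c + a *\<^sub>R rot (\<phi> + \<delta>) e \<in> K" by auto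
    then show ?case using elim by blast
  qed
  then obtain d where d: "d > 0" "\<And>\<delta>. \<bar>\<delta>\<bar> < d \<Longrightarrow> \<exists>t>0. c + t *\<^sub>R rot (\<phi> + \<delta>) e \<in> K"
    unfolding eventually_nhds_metric by (auto simp: dist_real_def)
  \<comment> \<open>Both \<open>\<phi> - \<delta>\<close> and \<open>\<phi> + \<delta>\<close> must
    be covered by \<open>d\<close>, and the bound 1 keeps \<open>\<delta>\<close> below
    \<open>pi\<close>, so that its sine is positive.\<close>
  define \<delta> where "\<delta> = min (d / 2) 1"
  have \<delta>: "0 < \<delta>" "\<delta> < d" "\<delta> < pi" using d(1) pi_gt3 by (auto simp: \<delta>_def)
  obtain s where s: "s > 0" "c + s *\<^sub>R rot (\<phi> - \<delta>) e \<in> K" using d(2)[of "- \<delta>"] \<delta> by auto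
  obtain t where t: "t > 0" "c + t *\<^sub>R rot (\<phi> + \<delta>) e \<in> K" using d(2)[of \<delta>] \<delta> by auto
  let ?n = "quarter_turn (rot \<phi> e)"
  \<comment> \<open>Signed distance from the line at angle \<open>\<phi>\<close>. Since both radii
    \<open>s\<close> and \<open>t\<close> are positive, the two points of \<open>K\<close> lie on
    opposite sides.\<close>
  have n: "?n \<bullet> (c + x *\<^sub>R rot \<psi> e - c) = x * sin (\<psi> - \<phi>)" for x \<psi>
    using inner_rot_quarter_turn_rot[of \<psi> e \<phi>] ee by (simp add: inner_commute)
  have "sin \<delta> > 0" using \<delta> by (intro sin_gt_zero)
  then have "?n \<bullet> (c + s *\<^sub>R rot (\<phi> - \<delta>) e - c) < 0" "?n \<bullet> (c + t *\<^sub>R rot (\<phi> + \<delta>) e - c) > 0"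
    unfolding n using s t by auto
  then obtain z where z: "z \<in> interior K" "?n \<bullet> (z - c) = 0"
    using convex_interior_zero[OF K(2,3) s(2) _ t(2)] by blast
  define k where "k = (z - c) \<bullet> rot \<phi> e"
  have "z - c = k *\<^sub>R rot \<phi> e"
    using orthonormal_expansion[of "rot \<phi> e" "z - c"] e z(2) by (simp add: k_def inner_commute)
  then have zk: "z = c + k *\<^sub>R rot \<phi> e" by (simp add: algebra_simps)
  \<comment> \<open>The positivity statement is used at \<open>\<delta> = 0\<close>, where it
    concerns the unrotated line.\<close>
  then have "k > 0"
    using eventually_nhds_x_imp_x[OF pos] z(1) interior_subset by auto
  with zk z(1) show ?thesis by (intro that) auto
qed

section \<open>The concurrency criterion and the derivative of the chord length\<close>

text \<open>A common point has the form \<open>c + t *\<^sub>R quarter_turn E\<close>. By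
  transversality each of the other two perpendiculars meets this line for exactly one
  \<open>t\<close>, so concurrency is equality of the two values.\<close>

lemma CPP_range_iff:
  fixes c u1 u2 E :: "real^2"
  assumes "norm E = 1" "u1 \<bullet> quarter_turn E \<noteq> 0" "u2 \<bullet> quarter_turn E \<noteq> 0"
    and A: "A = c + a *\<^sub>R E" and B: "B = c + b *\<^sub>R E"
  shows "CPP (range (\<lambda>s. A + s *\<^sub>R u1)) (range (\<lambda>s. B + s *\<^sub>R u2)) (range (\<lambda>t. c + t *\<^sub>R E)) A B c \<longleftrightarrow>
    a * ((u1 \<bullet> E) / (u1 \<bullet> quarter_turn E)) = b * ((u2 \<bullet> E) / (u2 \<bullet> quarter_turn E))"
proof -
  have foot: "(c + t *\<^sub>R quarter_turn E - (c + r *\<^sub>R E)) \<bullet> u = 0 \<longleftrightarrow>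
      t = r * ((u \<bullet> E) / (u \<bullet> quarter_turn E))" if "u \<bullet> quarter_turn E \<noteq> 0" for r t u
    using that by (simp add: inner_diff_left inner_commute[of _ u] inner_diff_right field_simps)
  have perp: "(x - c) \<bullet> E = 0 \<longleftrightarrow> (\<exists>t. x = c + t *\<^sub>R quarter_turn E)" for x
  proof
    assume "(x - c) \<bullet> E = 0"
    then have "x - c = ((x - c) \<bullet> quarter_turn E) *\<^sub>R quarter_turn E"
      using orthonormal_expansion[OF assms(1), of "x - c"] by simp
    then show "\<exists>t. x = c + t *\<^sub>R quarter_turn E" by (metis add.commute diff_add_cancel)
  qed auto
  have "CPP (range (\<lambda>s. A + s *\<^sub>R u1)) (range (\<lambda>s. B + s *\<^sub>R u2)) (range (\<lambda>t. c + t *\<^sub>R E)) A B c \<longleftrightarrow>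
    (\<exists>t. (c + t *\<^sub>R quarter_turn E - A) \<bullet> u1 = 0 \<and> (c + t *\<^sub>R quarter_turn E - B) \<bullet> u2 = 0)"
    unfolding CPP_def perpendicular_at_range mem_Collect_eq perp by blast
  then show ?thesis
    unfolding A B foot[OF assms(2)] foot[OF assms(3)] by simp
qed

text \<open>The hypothesis \<open>t0 > 0\<close> orients \<open>e\<close> so that the chord lies on
  the positive ray. Its length is then the difference of the upper and lower parameter ends.\<close>

lemma chord_length_derivative:
  fixes K :: "(real^2) set"
  assumes K: "closed K" "convex K" "interior K \<noteq> {}" "smooth_boundary K" "c \<notin> K"
    and e: "norm e = 1" and L0: "L0 = range (\<lambda>t. c + t *\<^sub>R e)"
    and \<phi>: "\<phi> \<in> interior (chord_dom c L0 K)"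
    and A: "c + t0 *\<^sub>R rot \<phi> e \<in> K" "t0 > 0"
  obtains g' where "(chord_length c L0 K has_real_derivative g') (at \<phi>)" "g' = 0 \<longleftrightarrow> CPP_at c L0 K \<phi>"
proof -
  obtain t1 where t1: "t1 > 0" "c + t1 *\<^sub>R rot \<phi> e \<in> interior K"
    using chord_dom_interior_meets_interior[OF K(1,2,3,5) e \<phi>[unfolded L0] A] by blast
  define T where "T \<psi> = {t. c + t *\<^sub>R rot \<psi> e \<in> K}" for \<psi>
  \<comment> \<open>Supremum and infimum give total functions of the angle. They are the ends of the
    section only at angles in the domain.\<close>
  define a where "a \<psi> = Sup (T \<psi>)" for \<psi>
  define b where "b \<psi> = Inf (T \<psi>)" for \<psi>
  have sec: "T \<psi> = {b \<psi>..a \<psi>} \<and> b \<psi> \<le> a \<psi>" if \<psi>: "\<psi> \<in> chord_dom c L0 K" for \<psi>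
  proof -
    obtain x y where "x \<le> y" "T \<psi> = {x..y}"
      using chord_dom_section[OF e \<psi>[unfolded L0]] unfolding T_def by metis
    then show ?thesis by (simp add: a_def b_def)
  qed
  have D: "\<forall>\<^sub>F \<psi> in nhds \<phi>. \<psi> \<in> chord_dom c L0 K"
    using \<phi> by (rule eventually_nhds_in_nhd)
  have "((\<lambda>\<psi>. c + t1 *\<^sub>R rot \<psi> e) \<longlongrightarrow> c + t1 *\<^sub>R rot \<phi> e) (at \<phi>)"
    by (intro tendsto_intros tendsto_rot)
  then have "\<forall>\<^sub>F \<psi> in at \<phi>. c + t1 *\<^sub>R rot \<psi> e \<in> interior K"
    using t1(2) by (intro topological_tendstoD) auto
  then have "\<forall>\<^sub>F \<psi> in nhds \<phi>. c + t1 *\<^sub>R rot \<psi> e \<in> interior K"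
    using t1(2) by (simp add: eventually_nhds_conv_at)
  with D have near: "\<forall>\<^sub>F \<psi> in nhds \<phi>. T \<psi> = {b \<psi>..a \<psi>} \<and> b \<psi> \<le> a \<psi> \<and> 0 < b \<psi>"
  proof eventually_elim
    case (elim \<psi>)
    \<comment> \<open>The section is an interval that contains the positive number \<open>t1\<close>
      and omits 0, so its lower end is positive.\<close>
    have "t1 \<in> T \<psi>" using elim interior_subset by (auto simp: T_def)
    moreover have "0 \<notin> T \<psi>" using K(5) by (simp add: T_def)
    ultimately show ?case using sec[OF elim(1)] t1(1) by auto
  qed
  from eventually_nhds_x_imp_x[OF this]
  have near\<phi>: "T \<phi> = {b \<phi>..a \<phi>}" "b \<phi> \<le> a \<phi>" "0 < b \<phi>"
    by blast+
  define P where "P = c + a \<phi> *\<^sub>R rot \<phi> e"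
  define Q where "Q = c + b \<phi> *\<^sub>R rot \<phi> e"
  have ends: "far_end c L0 K \<phi> = P" "near_end c L0 K \<phi> = Q"
    unfolding L0 P_def Q_def
    using chord_ends[OF e near\<phi>(1)[unfolded T_def] near\<phi>(3,2)] by auto
  have secA: "\<forall>\<^sub>F \<psi> in nhds \<phi>. {t. c + t *\<^sub>R rot \<psi> e \<in> K} = {b \<psi>..a \<psi>}"
    using near by eventually_elim (simp add: T_def)
  have secB: "\<forall>\<^sub>F \<psi> in nhds \<phi>. {t. c + t *\<^sub>R rot \<psi> (- e) \<in> K} = {- a \<psi>..- b \<psi>}"
    using secA
  proof eventually_elim
    case (elim \<psi>)
    have "c + t *\<^sub>R rot \<psi> (- e) \<in> K \<longleftrightarrow> - t \<in> {b \<psi>..a \<psi>}" for t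
      unfolding elim[symmetric] by (simp add: rot_minus)
    then have "{t. c + t *\<^sub>R rot \<psi> (- e) \<in> K} = {t. - t \<in> {b \<psi>..a \<psi>}}" by blast
    also have "\<dots> = {- a \<psi>..- b \<psi>}" by auto
    finally show ?case .
  qed
  obtain u1 where u1: "tangent_at (frontier K) P = range (\<lambda>s. P + s *\<^sub>R u1)"
    "u1 \<bullet> quarter_turn (rot \<phi> e) \<noteq> 0"
    "(a has_real_derivative a \<phi> * ((u1 \<bullet> rot \<phi> e) / (u1 \<bullet> quarter_turn (rot \<phi> e)))) (at \<phi>)"
    by (rule section_end_derivative[OF K(1,2,4) e secA t1(2) P_def])
  have e': "norm (- e) = 1" and t1': "c + (- t1) *\<^sub>R rot \<phi> (- e) \<in> interior K"
    and Q': "Q = c + (- b \<phi>) *\<^sub>R rot \<phi> (- e)"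
    using e t1(2) by (auto simp: rot_minus Q_def)
  obtain u2 where u2: "tangent_at (frontier K) Q = range (\<lambda>s. Q + s *\<^sub>R u2)"
    "u2 \<bullet> quarter_turn (rot \<phi> (- e)) \<noteq> 0"
    "((\<lambda>\<psi>. - b \<psi>) has_real_derivative
      - b \<phi> * ((u2 \<bullet> rot \<phi> (- e)) / (u2 \<bullet> quarter_turn (rot \<phi> (- e))))) (at \<phi>)"
    by (rule section_end_derivative[OF K(1,2,4) e' secB t1' Q'])
  define g' where "g' = a \<phi> * ((u1 \<bullet> rot \<phi> e) / (u1 \<bullet> quarter_turn (rot \<phi> e)))
    - b \<phi> * ((u2 \<bullet> rot \<phi> e) / (u2 \<bullet> quarter_turn (rot \<phi> e)))"
  \<comment> \<open>Reversing \<open>e\<close> changes the sign of both numerator and denominator in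
    the quotient for \<open>u2\<close>, so the quotient itself is unchanged.\<close>
  have ab: "((\<lambda>\<psi>. a \<psi> + - b \<psi>) has_real_derivative g') (at \<phi>)"
    using DERIV_add[OF u1(3) u2(3)] by (simp add: g'_def rot_minus quarter_turn_minus)
  have len: "\<forall>\<^sub>F \<psi> in nhds \<phi>. chord_length c L0 K \<psi> = a \<psi> + - b \<psi>"
    using near
  proof eventually_elim
    case (elim \<psi>)
    then show ?case
      unfolding L0 using chord_ends(3)[OF e, of c \<psi> K "b \<psi>" "a \<psi>"] by (simp add: T_def)
  qed
  have "(chord_length c L0 K has_real_derivative g') (at \<phi>)"
    using DERIV_cong_ev[OF refl len refl] ab by (rule iffD2)
  moreover have "g' = 0 \<longleftrightarrow> CPP_at c L0 K \<phi>"
    unfolding CPP_at_def ends u1(1) u2(1) g'_def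
    unfolding L0 rotated_line_range
    using CPP_range_iff[of "rot \<phi> e" u1 u2 P c "a \<phi>" Q "b \<phi>"] e u1(2) u2(2)
    by (simp add: P_def Q_def rot_minus quarter_turn_minus)
  ultimately show ?thesis by (rule that)
qed

theorem proposition17:
  fixes K L0 :: "(real^2) set" and c :: "real^2"
  assumes "closed K" and "convex K" and "interior K \<noteq> {}" and "smooth_boundary K"
    and "c \<notin> K"
    and "is_line L0" and "c \<in> L0"
  shows "(\<forall>\<phi> \<in> interior (chord_dom c L0 K).
            chord_length c L0 K differentiable (at \<phi>) \<and>
            (deriv (chord_length c L0 K) \<phi> = 0 \<longleftrightarrow> CPP_at c L0 K \<phi>)) \<and>
         (\<forall>\<phi> \<in> interior (chord_dom c L0 K).
            local_minimizer (chord_dom c L0 K) (chord_length c L0 K) \<phi> \<or>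
            local_maximizer (chord_dom c L0 K) (chord_length c L0 K) \<phi> \<longrightarrow>
            CPP_at c L0 K \<phi>)"
proof -
  let ?D = "chord_dom c L0 K" and ?g = "chord_length c L0 K"
  obtain e where e: "norm e = 1" "L0 = range (\<lambda>t. c + t *\<^sub>R e)"
    using is_line_through[OF assms(6,7)] .
  have der: "\<exists>g'. (?g has_real_derivative g') (at \<phi>) \<and> (g' = 0 \<longleftrightarrow> CPP_at c L0 K \<phi>)"
    if \<phi>: "\<phi> \<in> interior ?D" for \<phi>
  proof -
    have "\<phi> \<in> ?D" using \<phi> interior_subset by blast
    then obtain a b where "b \<le> a" "{t. c + t *\<^sub>R rot \<phi> e \<in> K} = {b..a}"
      using chord_dom_section[OF e(1)] e(2) by metis
    then have t: "c + a *\<^sub>R rot \<phi> e \<in> K" by auto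
    then have "a \<noteq> 0" using assms(5) by auto
    \<comment> \<open>The sign of \<open>a\<close> tells on which ray from \<open>c\<close> the
      chord lies. On the negative one, the same line is parametrised by \<open>- e\<close>.\<close>
    then consider "a > 0" | "- a > 0" by linarith
    then show ?thesis
    proof cases
      case 1
      then show ?thesis
        using chord_length_derivative[OF assms(1-5) e \<phi> t] by blast
    next
      case 2
      have "L0 = range (\<lambda>t. c + t *\<^sub>R (- e))"
        unfolding e(2) by (auto simp: image_iff) (metis minus_minus scaleR_minus_left add_uminus_conv_diff)+
      moreover have "c + (- a) *\<^sub>R rot \<phi> (- e) \<in> K" using t by (simp add: rot_minus)
      ultimately show ?thesis
        using chord_length_derivative[OF assms(1-5) _ _ \<phi>, of "- e" "- a"] e(1) 2 by auto
    qed
  qed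
  have "?g differentiable (at \<phi>) \<and> (deriv ?g \<phi> = 0 \<longleftrightarrow> CPP_at c L0 K \<phi>)"
    if "\<phi> \<in> interior ?D" for \<phi>
    using der[OF that] by (metis DERIV_imp_deriv real_differentiable_def)
  moreover have "CPP_at c L0 K \<phi>"
    if \<phi>: "\<phi> \<in> interior ?D" and ext: "local_minimizer ?D ?g \<phi> \<or> local_maximizer ?D ?g \<phi>" for \<phi>
  proof -
    obtain g' where g': "(?g has_real_derivative g') (at \<phi>)" "g' = 0 \<longleftrightarrow> CPP_at c L0 K \<phi>"
      using der[OF \<phi>] by blast
    \<comment> \<open>Within this ball the restriction to the domain is void, so the extremum is a
      two-sided one and the derivative vanishes.\<close>
    obtain r where r: "r > 0" "ball \<phi> r \<subseteq> ?D" using \<phi> by (auto simp: mem_interior)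
    from ext have "g' = 0"
    proof
      assume "local_minimizer ?D ?g \<phi>"
      then obtain d where "d > 0" "\<forall>y\<in>?D. \<bar>y - \<phi>\<bar> < d \<longrightarrow> ?g \<phi> \<le> ?g y"
        by (auto simp: local_minimizer_def)
      with r show ?thesis
        by (intro DERIV_local_min[OF g'(1), of "min d r"]) (auto simp: subset_iff dist_real_def abs_minus_commute)
    next
      assume "local_maximizer ?D ?g \<phi>"
      then obtain d where "d > 0" "\<forall>y\<in>?D. \<bar>y - \<phi>\<bar> < d \<longrightarrow> ?g y \<le> ?g \<phi>"
        by (auto simp: local_maximizer_def)
      with r show ?thesis
        by (intro DERIV_local_max[OF g'(1), of "min d r"]) (auto simp: subset_iff dist_real_def abs_minus_commute)
    qed
    then show ?thesis using g'(2) by blast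
  qed
  ultimately show ?thesis by blast
qed

end
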